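(* Let $r,m,n\ge 1$ be integers, and let $p_1,\dots,p_r$ and $g_1,\dots,g_m$ be SOS-convex polynomials on $\mathbb{R}^n$ such that $\mathcal F:=\{x\in\mathbb{R}^n : g_i(x)\le 0,\ i=1,\dots,m\}\neq\emptyset$. Let $d$ be the smallest even number such that $d\ge\max\{\max_j\deg p_j,\ \max_i\deg g_i\}$. Consider $$(P)\quad \inf_{x\in\mathcal F}\ \max_{1\le j\le r}p_j(x)$$ and $$(D)\quad \sup\Big\{\mu : \sum_{j=1}^r\delta_jp_j+\sum_{i=1}^m\lambda_ig_i-\mu\in\Sigma^2_d,\ \delta\in\Delta,\ \lambda\in\mathbb{R}^m_+,\ \mu\in\mathbb{R}\Big\}.$$ Then $\inf(P)=\sup(D)$ (as extended real numbers).
   Context: $\mathbb{R}^k_+$ denotes the set of vectors in $\mathbb{R}^k$ with nonnegative coordinates, and $\Delta:=\{\delta\in\mathbb{R}^r_+ : \sum_{j=1}^r\delta_j=1\}$. A real polynomial $f$ on $\mathbb{R}^n$ is a sum of squares if $f=\sum_{l=1}^s f_l^2$ for some real polynomials $f_1,\dots,f_s$; $\Sigma^2_d$ is the set of sum of squares real polynomials on $\mathbb{R}^n$ of degree at most $d$. A real polynomial $f$ on $\mathbb{R}^n$ is SOS-convex if its Hessian is an SOS-matrix polynomial, i.e. $\nabla^2 f(x)=H(x)H(x)^T$ for some $s\in\mathbb{N}$ and some matrix polynomial $H\in\mathbb{R}[x]^{n\times s}$. $\inf(P)$ and $\sup(D)$ denote the optimal values in $[-\infty,+\infty]$, with $\sup\emptyset=-\infty$.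 *)

theory Defs
  imports "HOL-Analysis.Analysis" "HOL-Library.Poly_Mapping"
begin

text \<open>
  The ring of real polynomials in the variables indexed by \<open>'n\<close>: a polynomial is the finitely
  supported family of its coefficients, indexed by exponent vectors; multiplication is the
  convolution product of \<^theory>\<open>HOL-Library.Poly_Mapping\<close>. With \<open>'n\<close> finite, these are the real
  polynomials on \<open>real ^ 'n\<close>.
\<close>

type_synonym 'n rpoly = "('n \<Rightarrow>\<^sub>0 nat) \<Rightarrow>\<^sub>0 real"

definition rconst :: "real \<Rightarrow> 'n rpoly" where
  "rconst c = Poly_Mapping.single 0 c"

definition reval :: "'n::finite rpoly \<Rightarrow> real ^ 'n \<Rightarrow> real" where
  "reval f x = (\<Sum>a\<in>Poly_Mapping.keys f. Poly_Mapping.lookup f a *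
     (\<Prod>i\<in>UNIV. (x $ i) ^ Poly_Mapping.lookup a i))"

text \<open>Total degree; the zero polynomial has degree 0.\<close>

definition rdegree :: "'n::finite rpoly \<Rightarrow> nat" where
  "rdegree f = Max (insert 0 ((\<lambda>a. \<Sum>i\<in>UNIV. Poly_Mapping.lookup a i) ` Poly_Mapping.keys f))"

text \<open>
  Formal partial derivative. Exponent subtraction truncates at 0, but then the coefficient
  vanishes. Lemma \<open>reval_has_partial_derivative\<close> below relates it to the analytic derivative.
\<close>

definition rpartial :: "'n \<Rightarrow> 'n rpoly \<Rightarrow> 'n rpoly" where
  "rpartial i f = (\<Sum>a\<in>Poly_Mapping.keys f. Poly_Mapping.single (a - Poly_Mapping.single i 1)
     (Poly_Mapping.lookup f a * real (Poly_Mapping.lookup a i)))"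

definition rhessian :: "'n rpoly \<Rightarrow> 'n \<Rightarrow> 'n \<Rightarrow> 'n rpoly" where
  "rhessian f i j = rpartial i (rpartial j f)"

text \<open>
  A matrix polynomial with rows indexed by \<open>'n\<close> and \<open>s\<close> columns is a function \<open>H\<close> of which only
  the entries \<open>H i k\<close> with \<open>k < s\<close> matter; the right-hand side is the \<open>(i, j)\<close> entry of the
  product of \<open>H\<close> with its transpose.
\<close>

definition sos_convex :: "'n rpoly \<Rightarrow> bool" where
  "sos_convex f \<longleftrightarrow> (\<exists>(s::nat) (H :: 'n \<Rightarrow> nat \<Rightarrow> 'n rpoly).
     \<forall>i j. rhessian f i j = (\<Sum>k<s. H i k * H j k))"

definition sum_of_squares :: "'n rpoly \<Rightarrow> bool" where
  "sum_of_squares f \<longleftrightarrow> (\<exists>(s::nat) (h :: nat \<Rightarrow> 'n rpoly). f = (\<Sum>l<s. (h l)\<^sup>2))"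

definition sos_upto :: "nat \<Rightarrow> 'n::finite rpoly set" where
  "sos_upto d = {f. sum_of_squares f \<and> rdegree f \<le> d}"

definition prob_simplex :: "(real ^ 'r) set" where
  "prob_simplex = {\<delta>. (\<forall>j. 0 \<le> \<delta> $ j) \<and> (\<Sum>j\<in>UNIV. \<delta> $ j) = 1}"

definition feasible_set :: "('m \<Rightarrow> 'n::finite rpoly) \<Rightarrow> (real ^ 'n) set" where
  "feasible_set g = {x. \<forall>i. reval (g i) x \<le> 0}"

definition primal_value :: "('r::finite \<Rightarrow> 'n::finite rpoly) \<Rightarrow> ('m::finite \<Rightarrow> 'n rpoly) \<Rightarrow> ereal" where
  "primal_value p g = (INF x\<in>feasible_set g. ereal (MAX j. reval (p j) x))"

definition dual_value ::
  "nat \<Rightarrow> ('r::finite \<Rightarrow> 'n::finite rpoly) \<Rightarrow> ('m::finite \<Rightarrow> 'n rpoly) \<Rightarrow> ereal" where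
  "dual_value d p g = Sup {ereal \<mu> | \<mu> (\<delta> :: real ^ 'r) (lam :: real ^ 'm).
     (\<Sum>j\<in>UNIV. rconst (\<delta> $ j) * p j) + (\<Sum>i\<in>UNIV. rconst (lam $ i) * g i) - rconst \<mu>
       \<in> sos_upto d \<and>
     \<delta> \<in> prob_simplex \<and> (\<forall>i. 0 \<le> lam $ i)}"

lemma rpoly_eq_sum_monomials:
  "f = (\<Sum>a\<in>Poly_Mapping.keys f. Poly_Mapping.single a (Poly_Mapping.lookup f a))"
  by (rule poly_mapping_eqI)
     (simp add: lookup_sum lookup_single when_def sum.delta' in_keys_iff)

lemma reval_zero [simp]: "reval 0 x = 0"
  by (simp add: reval_def)

lemma reval_add: "reval (f + g) x = reval f x + reval g x"
  unfolding reval_def by (rule setsum_keys_plus_distrib) (simp_all add: algebra_simps)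

lemma reval_sum: "reval (\<Sum>k\<in>A. F k) x = (\<Sum>k\<in>A. reval (F k) x)"
  by (induction A rule: infinite_finite_induct) (simp_all add: reval_add)

lemma reval_single:
  "reval (Poly_Mapping.single a c) x = c * (\<Prod>i\<in>UNIV. (x $ i) ^ Poly_Mapping.lookup a i)"
  by (cases "c = 0") (simp_all add: reval_def)

lemma reval_rconst [simp]: "reval (rconst c) x = c"
  by (simp add: rconst_def reval_single)

lemma reval_mult: "reval (f * g) x = reval f x * reval g x"
proof -
  have "f * g = (\<Sum>a\<in>Poly_Mapping.keys f. \<Sum>b\<in>Poly_Mapping.keys g.
      Poly_Mapping.single (a + b) (Poly_Mapping.lookup f a * Poly_Mapping.lookup g b))"
    by (subst rpoly_eq_sum_monomials[of f], subst rpoly_eq_sum_monomials[of g])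
       (simp add: sum_product mult_single)
  then show ?thesis
    by (simp add: reval_sum reval_single lookup_add power_add prod.distrib reval_def[of f]
        reval_def[of g] sum_product mult_ac)
qed

lemma reval_has_partial_derivative:
  fixes f :: "'n::finite rpoly"
  shows "((\<lambda>t. reval f (x + t *\<^sub>R axis i 1)) has_real_derivative reval (rpartial i f) x) (at 0)"
proof -
  let ?m = "\<lambda>a y. \<Prod>k\<in>UNIV. (y $ k) ^ Poly_Mapping.lookup a k"
  have split: "?m a y = (y $ i) ^ Poly_Mapping.lookup a i *
      (\<Prod>k\<in>UNIV-{i}. (y $ k) ^ Poly_Mapping.lookup a k)" for a and y :: "real ^ 'n"
    by (rule prod.remove) auto
  have D: "((\<lambda>t. ?m a (x + t *\<^sub>R axis i 1)) has_real_derivative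
      real (Poly_Mapping.lookup a i) * ?m (a - Poly_Mapping.single i 1) x) (at 0)" for a
  proof -
    let ?c = "\<Prod>k\<in>UNIV-{i}. (x $ k) ^ Poly_Mapping.lookup a k"
    have 1: "(\<lambda>t. ?m a (x + t *\<^sub>R axis i 1)) = (\<lambda>t. (x $ i + t) ^ Poly_Mapping.lookup a i * ?c)"
      by (subst split) (auto simp: axis_def intro!: ext prod.cong)
    have 2: "?m (a - Poly_Mapping.single i 1) x = (x $ i) ^ (Poly_Mapping.lookup a i - 1) * ?c"
      by (subst split) (auto simp: lookup_minus lookup_single when_def intro!: prod.cong)
    show ?thesis
      unfolding 1 2 by (auto intro!: derivative_eq_intros)
  qed
  have "((\<lambda>t. \<Sum>a\<in>Poly_Mapping.keys f. Poly_Mapping.lookup f a * ?m a (x + t *\<^sub>R axis i 1))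
     has_real_derivative (\<Sum>a\<in>Poly_Mapping.keys f. Poly_Mapping.lookup f a *
       (real (Poly_Mapping.lookup a i) * ?m (a - Poly_Mapping.single i 1) x))) (at 0)"
    by (intro DERIV_sum DERIV_cmult D)
  then show ?thesis
    by (simp add: reval_def[of f] rpartial_def reval_sum reval_single mult.assoc)
qed

end

theory Submission
  imports Defs "HOL-Computational_Algebra.Fundamental_Theorem_Algebra"
begin

text \<open>
  If a system of convex polynomial inequalities \<open>f\<^sub>i \<le> e\<close> is solvable for every \<open>e > 0\<close>, it is solvable
  for \<open>e = 0\<close>. Hence the upward closure of the image of \<open>(f\<^sub>i)\<close> is closed and convex, and separating
  it from 0 provides multipliers without any constraint qualification. The same fact shows that the
  resulting Lagrangian, being bounded below, attains its minimum at some \<open>y\<close>. For SOS-convex \<open>f\<close> the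
  remainder of the first-order Taylor expansion at \<open>y\<close> is a sum of squares; in the Lagrangian the
  first-order terms at the minimizer cancel, so that subtracting any lower bound leaves a sum of
  squares.
\<close>

section \<open>Convex functions that are polynomial along lines\<close>

lemma convex_on_diff_const:
  fixes f :: "'a::real_vector \<Rightarrow> real"
  assumes "convex_on S f"
  shows "convex_on S (\<lambda>x. f x - c)"
proof (rule convex_onI)
  fix t :: real and x y assume "0 < t" "t < 1" "x \<in> S" "y \<in> S"
  then show "f ((1 - t) *\<^sub>R x + t *\<^sub>R y) - c \<le> (1 - t) * (f x - c) + t * (f y - c)"
    using convex_onD[OF assms, of t x y] by (simp add: algebra_simps)
qed (use assms in \<open>simp add: convex_on_def\<close>)

text \<open>The point \<open>x + t *\<^sub>R v\<close> is a limit of points on the segments from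
  \<open>x\<close> to \<open>X k\<close>, taken with weight \<open>c k = t / norm (X k)\<close>,
  which tends to 0. Convexity bounds the values there by \<open>(1 - c k) * f x + c k * B\<close>,
  and this tends to \<open>f x\<close>.\<close>

lemma convex_on_recession_le:
  fixes f :: "'a::euclidean_space \<Rightarrow> real"
  assumes conv: "convex_on UNIV f"
    and inf: "filterlim (\<lambda>k. norm (X k)) at_top sequentially"
    and dir: "(\<lambda>k. sgn (X k)) \<longlonglongrightarrow> v"
    and bound: "\<And>k::nat. f (X k) \<le> B" and t: "0 \<le> t"
  shows "f (x + t *\<^sub>R v) \<le> f x"
proof -
  define c where "c k = t / norm (X k)" for k
  have c0: "c \<longlonglongrightarrow> 0"
    unfolding c_def using inf by (intro tendsto_divide_0[OF tendsto_const] filterlim_at_top_imp_at_infinity)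
  have eq: "(1 - c k) *\<^sub>R x + c k *\<^sub>R X k = x - c k *\<^sub>R x + t *\<^sub>R sgn (X k)" for k
    by (simp add: c_def sgn_div_norm algebra_simps divide_inverse)
  have "(\<lambda>k. x - c k *\<^sub>R x + t *\<^sub>R sgn (X k)) \<longlonglongrightarrow> x - 0 *\<^sub>R x + t *\<^sub>R v"
    by (intro tendsto_intros c0 dir)
  then have lim: "(\<lambda>k. x - c k *\<^sub>R x + t *\<^sub>R sgn (X k)) \<longlonglongrightarrow> x + t *\<^sub>R v"
    by simp
  have cont: "isCont f (x + t *\<^sub>R v)"
    using convex_on_continuous[OF open_UNIV conv] by (simp add: continuous_on_eq_continuous_at)
  have 1: "(\<lambda>k. f (x - c k *\<^sub>R x + t *\<^sub>R sgn (X k))) \<longlonglongrightarrow> f (x + t *\<^sub>R v)"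
    by (rule isCont_tendsto_compose[OF cont lim])
  have 2: "(\<lambda>k. (1 - c k) * f x + c k * B) \<longlonglongrightarrow> (1 - 0) * f x + 0 * B"
    by (intro tendsto_intros c0)
  have "\<forall>\<^sub>F k in sequentially. c k < 1"
    using order_tendstoD(2)[OF c0] by simp
  then have "\<forall>\<^sub>F k in sequentially. f (x - c k *\<^sub>R x + t *\<^sub>R sgn (X k)) \<le> (1 - c k) * f x + c k * B"
  proof eventually_elim
    case (elim k)
    have "0 \<le> c k" using t by (simp add: c_def)
    then show ?case
      using convex_onD[OF conv, of "c k" x "X k"] elim mult_left_mono[OF bound, of "c k" k]
      by (simp add: eq)
  qed
  then show ?thesis
    using tendsto_le[OF sequentially_bot 2 1] by simp
qed

text \<open>The difference quotient \<open>r\<close> of \<open>q\<close> at 0 is bounded on t \<ge>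
  1: above by 0 because \<open>q\<close> decreases, below by convexity through -1, 0 and t. A
  polynomial bounded on a half-line is constant.\<close>

lemma convex_antimono_poly_affine:
  fixes q :: "real poly"
  assumes conv: "convex_on UNIV (poly q)" and anti: "\<And>s t. s \<le> t \<Longrightarrow> poly q t \<le> poly q s"
  shows "\<exists>b\<le>0. \<forall>t. poly q t = poly q 0 + t * b"
proof -
  obtain a r where q: "q = pCons a r" by (cases q)
  obtain b r' where r: "r = pCons b r'" by (cases r)
  define D where "D = poly q (-1) - poly q 0"
  have bd: "\<bar>poly r t\<bar> \<le> D" if t: "1 \<le> t" for t
  proof -
    \<comment> \<open>The weight 1/(1+t) is the one that expresses 0 as a convex combination of -1
      and t.\<close>
    have "poly q ((1 - 1/(1+t)) *\<^sub>R (-1) + (1/(1+t)) *\<^sub>R t) \<le> (1 - 1/(1+t)) * poly q (-1) + (1/(1+t)) * poly q t"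
      using t by (intro convex_onD[OF conv]) auto
    moreover have "(1 - 1/(1+t)) *\<^sub>R (-1) + (1/(1+t)) *\<^sub>R t = 0"
      using t by (simp add: field_simps)
    ultimately have "(1+t) * poly q 0 \<le> (1+t) * ((1 - 1/(1+t)) * poly q (-1) + (1/(1+t)) * poly q t)"
      using t by (intro mult_left_mono) auto
    also have "\<dots> = t * poly q (-1) + poly q t"
    proof -
      have "s * ((1 - 1/s) * A + (1/s) * B) = (s - 1) * A + B" if "s \<noteq> 0" for s A B :: real
        using that by (simp add: field_simps)
      from this[of "1 + t"] t show ?thesis by simp
    qed
    finally have "t * poly r t \<ge> t * (- D)"
      by (simp add: D_def q algebra_simps)
    moreover have "t * poly r t \<le> 0"
      using anti[of 0 t] t by (simp add: q)
    ultimately have "- D \<le> poly r t" "poly r t \<le> 0"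
      using t mult_le_cancel_left_pos[of t "- D" "poly r t"] by (auto simp: mult_le_0_iff)
    then show ?thesis by simp
  qed
  have "r' = 0"
  proof (rule ccontr)
    assume "r' \<noteq> 0"
    from poly_infinity[OF this, of "D + 1" b] obtain R where R: "\<And>z. R \<le> norm z \<Longrightarrow> D + 1 \<le> norm (poly r z)"
      unfolding r by blast
    show False using R[of "max 1 R"] bd[of "max 1 R"] by auto
  qed
  then have eq: "poly q t = poly q 0 + t * b" for t
    by (simp add: q r)
  moreover have "b \<le> 0" using anti[of 0 1] eq[of 1] by simp
  ultimately show ?thesis by blast
qed

text \<open>Going from \<open>x\<close> towards the far point
  \<open>y + (1 / c k) *\<^sub>R v\<close> with weight \<open>c k\<close> displaces by exactly
  \<open>v\<close> up to a vanishing error, and the affine growth along the line through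
  \<open>y\<close> contributes exactly \<open>b\<close>. Letting \<open>c k\<close> tend to 0
  compares the two slopes. This carries a negative slope along \<open>v\<close> from one base point
  to any other.\<close>

lemma convex_on_parallel_slope_le:
  fixes f :: "'a::euclidean_space \<Rightarrow> real"
  assumes conv: "convex_on UNIV f"
    and x: "f (x + v) = f x + a" and y: "\<And>t. f (y + t *\<^sub>R v) = f y + t * b"
  shows "a \<le> b"
proof -
  define c where "c k = inverse (real (Suc k))" for k
  have c0: "c \<longlonglongrightarrow> 0" unfolding c_def by (rule LIMSEQ_inverse_real_of_nat)
  have le: "f (x - c k *\<^sub>R x + c k *\<^sub>R y + v) \<le> (1 - c k) * f x + c k * f y + b" for k
  proof -
    have c: "0 < c k" "c k \<le> 1" by (auto simp: c_def field_simps)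
    have "(1 - c k) *\<^sub>R x + c k *\<^sub>R (y + (1 / c k) *\<^sub>R v) = x - c k *\<^sub>R x + c k *\<^sub>R y + v"
      using c by (simp add: algebra_simps)
    then show ?thesis
      using convex_onD[OF conv, of "c k" x "y + (1 / c k) *\<^sub>R v"] c y[of "1 / c k"]
      by (simp add: algebra_simps)
  qed
  have "(\<lambda>k. x - c k *\<^sub>R x + c k *\<^sub>R y + v) \<longlonglongrightarrow> x - 0 *\<^sub>R x + 0 *\<^sub>R y + v"
    by (intro tendsto_intros c0)
  then have lim: "(\<lambda>k. x - c k *\<^sub>R x + c k *\<^sub>R y + v) \<longlonglongrightarrow> x + v"
    by simp
  have cont: "isCont f (x + v)"
    using convex_on_continuous[OF open_UNIV conv] by (simp add: continuous_on_eq_continuous_at)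
  have 1: "(\<lambda>k. f (x - c k *\<^sub>R x + c k *\<^sub>R y + v)) \<longlonglongrightarrow> f (x + v)"
    by (rule isCont_tendsto_compose[OF cont lim])
  have 2: "(\<lambda>k. (1 - c k) * f x + c k * f y + b) \<longlonglongrightarrow> (1 - 0) * f x + 0 * f y + b"
    by (intro tendsto_intros c0)
  have "f (x + v) \<le> f x + b"
    using LIMSEQ_le[OF 1 2] le by simp
  then show ?thesis using x by simp
qed

text \<open>
  Take minimum-norm approximate solutions. If they are unbounded, they have a limit direction \<open>v\<close>
  along which all the functions are affine and nonincreasing. They cannot all be constant, since
  then the minimum-norm points would be orthogonal to \<open>v\<close>. A function with negative slope can be
  dropped: moving along \<open>v\<close> makes it as negative as desired.
\<close>

lemma convex_poly_system_attained:
  fixes f :: "'i \<Rightarrow> 'a::euclidean_space \<Rightarrow> real"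
  assumes "finite I" and "\<And>i. i \<in> I \<Longrightarrow> convex_on UNIV (f i)"
    and "\<And>i x v. i \<in> I \<Longrightarrow> \<exists>q. \<forall>t. f i (x + t *\<^sub>R v) = poly q t"
    and "\<And>e. e > 0 \<Longrightarrow> \<exists>x. \<forall>i\<in>I. f i x \<le> e"
  shows "\<exists>x. \<forall>i\<in>I. f i x \<le> 0"
  using assms
proof (induction I rule: finite_psubset_induct)
  case (psubset I)
  note conv = psubset.prems(1) and pol = psubset.prems(2) and approx = psubset.prems(3)
  have cont: "continuous_on UNIV (f i)" if "i \<in> I" for i
    using convex_on_continuous[OF open_UNIV conv[OF that]] .
  define e where "e k = inverse (real (Suc k))" for k
  define C where "C k = {x. \<forall>i\<in>I. f i x \<le> e k}" for k
  have C_eq: "C k = (\<Inter>i\<in>I. {x. f i x \<le> e k})" for k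
    by (auto simp: C_def)
  have closed: "closed (C k)" for k
    unfolding C_eq by (intro closed_INT ballI closed_Collect_le cont continuous_on_const)
  have nonempty: "C k \<noteq> {}" for k
    using approx[of "e k"] by (auto simp: C_def e_def)
  define X where "X k = closest_point (C k) 0" for k
  have X_in: "X k \<in> C k" for k
    unfolding X_def by (rule closest_point_in_set[OF closed nonempty])
  have X_min: "norm (X k) \<le> norm y" if "y \<in> C k" for y k
    using closest_point_le[OF closed that, of 0] by (simp add: X_def dist_norm)
  have e0: "e \<longlonglongrightarrow> 0" unfolding e_def by (rule LIMSEQ_inverse_real_of_nat)
  show ?case
  proof (cases "bounded (range X)")
    case True
    then obtain l \<sigma> where \<sigma>: "strict_mono \<sigma>" and l: "(X \<circ> \<sigma>) \<longlonglongrightarrow> l"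
      using bounded_imp_convergent_subsequence by blast
    have "f i l \<le> 0" if i: "i \<in> I" for i
    proof (rule LIMSEQ_le)
      show "(\<lambda>k. f i ((X \<circ> \<sigma>) k)) \<longlonglongrightarrow> f i l"
        using continuous_on_tendsto_compose[OF cont[OF i] l] by simp
      show "(e \<circ> \<sigma>) \<longlonglongrightarrow> 0" by (rule LIMSEQ_subseq_LIMSEQ[OF e0 \<sigma>])
      show "\<exists>N. \<forall>n\<ge>N. f i ((X \<circ> \<sigma>) n) \<le> (e \<circ> \<sigma>) n"
        using X_in i by (auto simp: C_def)
    qed
    then show ?thesis by blast
  next
    case False
    then have "\<exists>k. real n < norm (X k)" for n
      by (auto simp: bounded_iff not_le)
    then obtain r where r: "\<And>n. real n < norm (X (r n))" by metis
    have "bounded (range (\<lambda>n. sgn (X (r n))))"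
      by (rule boundedI[of _ 1]) (auto simp: norm_sgn)
    then obtain v \<sigma> where \<sigma>: "strict_mono \<sigma>" and v: "((\<lambda>n. sgn (X (r n))) \<circ> \<sigma>) \<longlonglongrightarrow> v"
      using bounded_imp_convergent_subsequence by blast
    define Y where "Y n = X (r (\<sigma> n))" for n
    have Yv: "(\<lambda>n. sgn (Y n)) \<longlonglongrightarrow> v"
      using v by (simp add: Y_def o_def)
    have Y_norm: "real n < norm (Y n)" for n
      using r[of "\<sigma> n"] seq_suble[OF \<sigma>, of n] by (simp add: Y_def)
    have Y_inf: "filterlim (\<lambda>n. norm (Y n)) at_top sequentially"
      by (rule filterlim_at_top_mono[OF filterlim_real_sequentially])
        (use Y_norm in \<open>auto intro!: always_eventually less_imp_le\<close>)
    \<comment> \<open>The indices \<open>r (\<sigma> n)\<close> need not increase, so nothing is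
      claimed about the tolerances tending to 0 along \<open>Y\<close>; the uniform bound
      \<open>e k \<le> 1\<close> suffices for the recession argument.\<close>
    have Y_bd: "f i (Y n) \<le> 1" if "i \<in> I" for i n
      using X_in[of "r (\<sigma> n)"] that inverse_le_1_iff[of "real (Suc (r (\<sigma> n)))"]
      by (fastforce simp: C_def Y_def e_def)
    have Y_nz: "Y n \<noteq> 0" for n using Y_norm[of n] by auto
    have "(\<lambda>n. norm (sgn (Y n))) \<longlonglongrightarrow> norm v"
      by (rule tendsto_norm[OF Yv])
    then have v1: "norm v = 1"
      using Y_nz by (simp add: norm_sgn LIMSEQ_const_iff)
    have decr: "f i (x + t *\<^sub>R v) \<le> f i x" if "i \<in> I" "0 \<le> t" for i x t
      using convex_on_recession_le[OF conv Y_inf Yv Y_bd] that by blast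
    have affine: "\<exists>b\<le>0. \<forall>t. f i (x + t *\<^sub>R v) = f i x + t * b" if i: "i \<in> I" for i x
    proof -
      obtain q where q: "\<And>t. f i (x + t *\<^sub>R v) = poly q t" using pol[OF i] by blast
      have "convex_on UNIV (poly q)"
      proof (rule convex_onI)
        fix t a b :: real assume "0 < t" "t < 1"
        then have "f i ((1 - t) *\<^sub>R (x + a *\<^sub>R v) + t *\<^sub>R (x + b *\<^sub>R v))
            \<le> (1 - t) * f i (x + a *\<^sub>R v) + t * f i (x + b *\<^sub>R v)"
          by (intro convex_onD[OF conv[OF i]]) auto
        moreover have "(1 - t) *\<^sub>R (x + a *\<^sub>R v) + t *\<^sub>R (x + b *\<^sub>R v)
            = x + ((1 - t) *\<^sub>R a + t *\<^sub>R b) *\<^sub>R v"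
          by (simp add: algebra_simps)
        ultimately show "poly q ((1 - t) *\<^sub>R a + t *\<^sub>R b) \<le> (1 - t) * poly q a + t * poly q b"
          by (simp only: q)
      qed simp
      moreover have "poly q t \<le> poly q s" if "s \<le> t" for s t
      proof -
        have "f i ((x + s *\<^sub>R v) + (t - s) *\<^sub>R v) \<le> f i (x + s *\<^sub>R v)"
          using that by (intro decr i) auto
        then show ?thesis by (simp add: q[symmetric] algebra_simps)
      qed
      ultimately have "\<exists>b\<le>0. \<forall>t. poly q t = poly q 0 + t * b"
        by (rule convex_antimono_poly_affine)
      then show ?thesis using q[of 0] by (auto simp: q)
    qed
    have "\<exists>i\<in>I. \<exists>x t. f i (x + t *\<^sub>R v) \<noteq> f i x"
    proof (rule ccontr)
      assume "\<not> ?thesis"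
      then have const: "\<And>i x t. i \<in> I \<Longrightarrow> f i (x + t *\<^sub>R v) = f i x" by blast
      have "sgn (Y n) \<bullet> v = 0" for n
      proof -
        \<comment> \<open>The component of \<open>Y n\<close> orthogonal to \<open>v\<close> meets
          the same constraints, since all functions are constant along \<open>v\<close>. Minimality
          of the norm forces \<open>Y n\<close> to be orthogonal to \<open>v\<close>, which
          contradicts the convergence of its directions to the unit vector \<open>v\<close>.\<close>
        define w where "w = Y n - (Y n \<bullet> v) *\<^sub>R v"
        have "w \<in> C (r (\<sigma> n))"
          using X_in[of "r (\<sigma> n)"] const[of _ "Y n" "- (Y n \<bullet> v)"] by (simp add: C_def w_def Y_def)
        then have "norm (Y n) \<le> norm w" using X_min by (simp add: Y_def)
        then have "Y n \<bullet> Y n \<le> w \<bullet> w" by (simp add: norm_le)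
        moreover have "v \<bullet> v = 1" using v1 by (simp add: dot_square_norm)
        ultimately have "(Y n \<bullet> v) * (Y n \<bullet> v) \<le> 0"
          by (simp add: w_def inner_diff_left inner_diff_right inner_commute)
        then have "Y n \<bullet> v = 0"
          by (metis antisym zero_le_square mult_eq_0_iff)
        then show ?thesis by (simp add: sgn_div_norm)
      qed
      moreover have "(\<lambda>n. sgn (Y n) \<bullet> v) \<longlonglongrightarrow> v \<bullet> v"
        by (intro tendsto_intros Yv)
      ultimately have "v \<bullet> v = 0" by (simp add: LIMSEQ_const_iff)
      then show False using v1 by simp
    qed
    then obtain i x t where i: "i \<in> I" and ne: "f i (x + t *\<^sub>R v) \<noteq> f i x" by blast
    have "\<exists>z. \<forall>j\<in>I - {i}. f j z \<le> 0"
    proof (rule psubset.IH)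
      show "\<exists>x. \<forall>j\<in>I - {i}. f j x \<le> e" if "0 < e" for e
        using approx[OF that] by blast
    qed (use i conv pol in auto)
    then obtain z where z: "\<And>j. j \<in> I - {i} \<Longrightarrow> f j z \<le> 0" by blast
    obtain a where a: "\<And>t. f i (z + t *\<^sub>R v) = f i z + t * a" using affine[OF i] by blast
    obtain b where b: "b \<le> 0" "\<And>t. f i (x + t *\<^sub>R v) = f i x + t * b" using affine[OF i] by blast
    \<comment> \<open>The nonzero slope was found at \<open>x\<close>, but the descent starts at
      \<open>z\<close>, the solution of the reduced system.\<close>
    have "a \<le> b"
      using convex_on_parallel_slope_le[OF conv[OF i], of z v a x b] a[of 1] b(2) by simp
    moreover have "b \<noteq> 0" using ne b(2)[of t] by auto
    ultimately have "a < 0" using b(1) by simp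
    \<comment> \<open>Moving by \<open>T\<close> lowers \<open>f i\<close> by exactly
      \<open>\<bar>f i z\<bar>\<close>, while the other functions do not increase.\<close>
    define T where "T = \<bar>f i z\<bar> / - a"
    have T: "0 \<le> T" "T * a = - \<bar>f i z\<bar>" using \<open>a < 0\<close> by (auto simp: T_def divide_nonneg_neg)
    have "f j (z + T *\<^sub>R v) \<le> 0" if "j \<in> I" for j
    proof (cases "j = i")
      case True then show ?thesis using a[of T] T by simp
    next
      case False then show ?thesis using z[of j] decr[OF that T(1), of z] that by simp
    qed
    then show ?thesis by blast
  qed
qed

text \<open>With \<open>m\<close> the infimum, the single inequality \<open>f x - m \<le> 0\<close>
  is solvable up to every positive tolerance, hence exactly. Polynomiality along lines is what
  excludes functions such as exp.\<close>

lemma convex_poly_attains_min: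
  fixes f :: "'a::euclidean_space \<Rightarrow> real"
  assumes conv: "convex_on UNIV f" and pol: "\<And>x v. \<exists>q. \<forall>t. f (x + t *\<^sub>R v) = poly q t"
    and bd: "\<And>x. c \<le> f x"
  shows "\<exists>y. \<forall>x. f y \<le> f x"
proof -
  have bdd: "bdd_below (range f)" using bd by (auto intro: bdd_belowI[of _ c])
  define m where "m = Inf (range f)"
  have "\<exists>x. \<forall>i\<in>{()}. f x - m \<le> 0"
  proof (rule convex_poly_system_attained[of "{()}" "\<lambda>_ x. f x - m"])
    show "convex_on UNIV (\<lambda>x. f x - m)"
      by (rule convex_on_diff_const[OF conv])
    show "\<exists>q. \<forall>t. f (x + t *\<^sub>R v) - m = poly q t" for x v
    proof -
      obtain q where "\<And>t. f (x + t *\<^sub>R v) = poly q t" using pol by blast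
      then show ?thesis by (intro exI[of _ "q - [:m:]"]) simp
    qed
    show "\<exists>x. \<forall>i\<in>{()}. f x - m \<le> e" if "0 < e" for e
    proof -
      have "Inf (range f) < m + e" using that by (simp add: m_def)
      then obtain x where "f x < m + e"
        using cInf_less_iff[OF _ bdd] by auto
      then show ?thesis by (intro exI[of _ x]) auto
    qed
  qed simp
  then obtain y where "f y \<le> m" by auto
  moreover have "m \<le> f x" for x unfolding m_def by (intro cInf_lower bdd) auto
  ultimately show ?thesis by (meson order.trans)
qed

lemma convex_poly_alternative:
  fixes f :: "'i::finite \<Rightarrow> 'a::euclidean_space \<Rightarrow> real"
  assumes conv: "\<And>i. convex_on UNIV (f i)"
    and pol: "\<And>i x v. \<exists>q. \<forall>t. f i (x + t *\<^sub>R v) = poly q t"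
    and infeasible: "\<And>x. \<exists>i. 0 < f i x"
  shows "\<exists>w b. (\<forall>i. 0 \<le> w i) \<and> 0 < b \<and> (\<forall>x. b \<le> (\<Sum>i\<in>UNIV. w i * f i x))"
proof -
  define S where "S = {u :: real ^ 'i. \<exists>x. \<forall>i. f i x \<le> u $ i}"
  have "convex S"
  proof (rule convexI)
    fix u w and s t :: real assume *: "u \<in> S" "w \<in> S" "0 \<le> s" "0 \<le> t" "s + t = 1"
    then obtain x y where x: "\<And>i. f i x \<le> u $ i" and y: "\<And>i. f i y \<le> w $ i"
      by (auto simp: S_def)
    have "f i (s *\<^sub>R x + t *\<^sub>R y) \<le> (s *\<^sub>R u + t *\<^sub>R w) $ i" for i
    proof -
      have "f i (s *\<^sub>R x + t *\<^sub>R y) \<le> s * f i x + t * f i y"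
        using conv[of i] * by (simp add: convex_on_def)
      also have "\<dots> \<le> s * u $ i + t * w $ i"
        using * by (intro add_mono mult_left_mono x y) auto
      finally show ?thesis by simp
    qed
    then show "s *\<^sub>R u + t *\<^sub>R w \<in> S" by (auto simp: S_def)
  qed
  moreover have "closed S"
  proof (unfold closed_sequential_limits, intro allI impI)
    fix U u assume *: "(\<forall>n. U n \<in> S) \<and> U \<longlonglongrightarrow> u"
    \<comment> \<open>A point witnessing that \<open>U n\<close> is in \<open>S\<close> solves the
      system for \<open>u\<close> with tolerance \<open>dist (U n) u\<close>.\<close>
    have "\<exists>x. \<forall>i\<in>UNIV. f i x - u $ i \<le> 0"
    proof (rule convex_poly_system_attained[of UNIV "\<lambda>i x. f i x - u $ i"])
      show "convex_on UNIV (\<lambda>x. f i x - u $ i)" for i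
        by (rule convex_on_diff_const[OF conv])
      show "\<exists>q. \<forall>t. f i (x + t *\<^sub>R v) - u $ i = poly q t" for i x v
      proof -
        obtain q where "\<And>t. f i (x + t *\<^sub>R v) = poly q t" using pol by blast
        then show ?thesis by (intro exI[of _ "q - [:u $ i:]"]) simp
      qed
      show "\<exists>x. \<forall>i\<in>UNIV. f i x - u $ i \<le> e" if e: "0 < e" for e
      proof -
        obtain n where n: "dist (U n) u < e"
          using * e unfolding lim_sequentially by blast
        obtain x where x: "\<And>i. f i x \<le> U n $ i" using * by (auto simp: S_def)
        have "f i x - u $ i \<le> e" for i
          using x[of i] component_le_norm_cart[of "U n - u" i] n by (auto simp: dist_norm)
        then show ?thesis by blast
      qed
    qed simp
    then show "u \<in> S" by (auto simp: S_def)
  qed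
  moreover have "0 \<notin> S"
    using infeasible by (auto simp: S_def) (metis not_le)
  ultimately obtain w b where b: "0 < b" and w: "\<And>u. u \<in> S \<Longrightarrow> b < w \<bullet> u"
    using separating_hyperplane_closed_point[of S 0] by auto
  have dot: "w \<bullet> u = (\<Sum>i\<in>UNIV. w $ i * u $ i)" for u
    by (simp add: inner_vec_def)
  have S_f: "(\<chi> i. f i x) \<in> S" for x by (auto simp: S_def)
  have "0 \<le> w $ i" for i
  proof (rule ccontr)
    assume neg: "\<not> 0 \<le> w $ i"
    define u :: "real ^ 'i" where "u = (\<chi> j. f j 0)"
    \<comment> \<open>\<open>S\<close> is closed under increasing coordinates. If
      \<open>w $ i\<close> were negative, a step of length \<open>T\<close> along axis
      \<open>i\<close> would bring the inner product with \<open>w\<close> down to at most 0, below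
      \<open>b\<close>.\<close>
    define T where "T = \<bar>w \<bullet> u\<bar> / - (w $ i)"
    have T: "0 \<le> T" "T * w $ i = - \<bar>w \<bullet> u\<bar>" using neg by (auto simp: T_def divide_nonneg_neg)
    have "u + T *\<^sub>R axis i 1 \<in> S"
      using T(1) by (auto simp: S_def u_def axis_def intro!: exI[of _ 0])
    from w[OF this] have "b < w \<bullet> u + T * w $ i"
      by (simp add: inner_add_right inner_axis)
    then show False using b T by simp
  qed
  moreover have "b \<le> (\<Sum>i\<in>UNIV. w $ i * f i x)" for x
    using w[OF S_f[of x]] by (simp add: dot)
  ultimately show ?thesis using b by (intro exI[of _ "\<lambda>i. w $ i"] exI[of _ b]) auto
qed

section \<open>Polynomials as functions\<close>

lemma reval_diff: "reval (f - g) x = reval f x - reval g x"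
  using reval_add[of "f - g" g x] by simp

lemma reval_one [simp]: "reval 1 x = 1"
  using reval_rconst[of 1 x] by (simp add: rconst_def)

lemma reval_power: "reval (f ^ k) x = reval f x ^ k"
  by (induction k) (simp_all add: reval_mult)

lemma reval_prod: "reval (\<Prod>k\<in>A. F k) x = (\<Prod>k\<in>A. reval (F k) x)"
  by (induction A rule: infinite_finite_induct) (simp_all add: reval_mult)

definition rvar :: "'n \<Rightarrow> 'n rpoly" where
  "rvar i = Poly_Mapping.single (Poly_Mapping.single i 1) 1"

lemma reval_rvar [simp]: "reval (rvar i) x = x $ i"
proof -
  have "(x $ k) ^ Poly_Mapping.lookup (Poly_Mapping.single i 1) k = (if k = i then x $ i else 1)" for k
    by (simp add: lookup_single when_def)
  then show ?thesis by (simp add: rvar_def reval_single)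
qed

text \<open>Truncated subtraction sends an exponent without variable \<open>i\<close> to the same
  place as its successor in \<open>i\<close>, but the former carries weight 0. So only one exponent
  contributes to each coefficient.\<close>

lemma lookup_rpartial:
  "Poly_Mapping.lookup (rpartial i f) b
     = Poly_Mapping.lookup f (b + Poly_Mapping.single i 1) * real (Suc (Poly_Mapping.lookup b i))"
proof -
  let ?e = "Poly_Mapping.single i 1 :: 'a \<Rightarrow>\<^sub>0 nat"
  have *: "(Poly_Mapping.lookup f a * real (Poly_Mapping.lookup a i) when a - ?e = b)
      = (if a = b + ?e then Poly_Mapping.lookup f a * real (Suc (Poly_Mapping.lookup b i)) else 0)" for a
  proof (cases "Poly_Mapping.lookup a i = 0")
    case True
    then have "a \<noteq> b + ?e" by (auto simp: lookup_add)
    then show ?thesis using True by simp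
  next
    case False
    then have "a - ?e = b \<longleftrightarrow> a = b + ?e"
      by (auto intro!: poly_mapping_eqI simp: lookup_add lookup_minus lookup_single when_def)
    then show ?thesis by (auto simp: when_def lookup_add)
  qed
  show ?thesis
    unfolding rpartial_def lookup_sum lookup_single *
    by (simp add: sum.delta in_keys_iff)
qed

lemma reval_at_zero: "reval f 0 = Poly_Mapping.lookup f 0"
proof -
  have monom: "(\<Prod>i\<in>UNIV. (0 :: real) ^ Poly_Mapping.lookup a i) = (if a = 0 then 1 else 0)"
    for a :: "'a \<Rightarrow>\<^sub>0 nat"
  proof (cases "a = 0")
    case False
    then obtain i where "Poly_Mapping.lookup a i \<noteq> 0"
      by (metis poly_mapping_eqI lookup_zero)
    then have "(\<Prod>i\<in>UNIV. (0 :: real) ^ Poly_Mapping.lookup a i) = 0"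
      by (intro prod_zero) (auto intro!: bexI[of _ i])
    then show ?thesis using False by simp
  qed simp
  show ?thesis
    unfolding reval_def zero_index monom by (simp add: in_keys_iff if_distrib cong: if_cong)
qed

text \<open>Differentiating lowers the exponent until the coefficient becomes the value at the origin.\<close>

lemma reval_eq_zero_imp_lookup:
  assumes "\<And>x. reval f x = 0"
  shows "Poly_Mapping.lookup f a = 0"
  using assms
proof (induction "\<Sum>i\<in>UNIV. Poly_Mapping.lookup a i" arbitrary: a f)
  case 0
  then have "a = 0" by (intro poly_mapping_eqI) simp
  then show ?case using 0(2)[of 0] by (simp add: reval_at_zero)
next
  case (Suc n)
  then obtain i where i: "Poly_Mapping.lookup a i \<noteq> 0"
    by (metis Suc_neq_Zero sum.neutral)
  define b where "b = a - Poly_Mapping.single i 1"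
  have a: "a = b + Poly_Mapping.single i 1"
    using i by (auto intro!: poly_mapping_eqI simp: b_def lookup_add lookup_minus lookup_single when_def)
  have "n = (\<Sum>i\<in>UNIV. Poly_Mapping.lookup b i)"
    using Suc(2) by (simp add: a lookup_add sum.distrib lookup_single when_def)
  moreover have "reval (rpartial i f) x = 0" for x
    using DERIV_unique[OF reval_has_partial_derivative[of f x i], of 0] Suc.prems by simp
  ultimately have "Poly_Mapping.lookup (rpartial i f) b = 0" by (rule Suc.hyps(1))
  then show ?case by (simp add: lookup_rpartial a)
qed

text \<open>Allows polynomial identities to be verified pointwise, where derivatives and minimizers
  are available.\<close>

lemma reval_inject:
  assumes "\<And>x. reval f x = reval g x"
  shows "f = g"
proof (rule poly_mapping_eqI)
  fix a
  have "Poly_Mapping.lookup (f - g) a = 0"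
    by (rule reval_eq_zero_imp_lookup) (simp add: reval_diff assms)
  then show "Poly_Mapping.lookup f a = Poly_Mapping.lookup g a" by (simp add: lookup_minus)
qed

lemma reval_line_poly: "\<exists>q. \<forall>t. reval f (x + t *\<^sub>R v) = poly q t"
  by (rule exI[of _ "\<Sum>a\<in>Poly_Mapping.keys f. smult (Poly_Mapping.lookup f a)
      (\<Prod>i\<in>UNIV. [:x $ i, v $ i:] ^ Poly_Mapping.lookup a i)"])
    (simp add: reval_def poly_sum poly_prod)

text \<open>Restriction to the line from \<open>y\<close> to \<open>x\<close> is a polynomial in t
  whose coefficients are themselves polynomials in \<open>x\<close>. This keeps the squares in the
  Taylor remainder polynomial in \<open>x\<close>.\<close>

lemma reval_line_rpoly:
  "\<exists>Q :: 'n::finite rpoly poly. \<forall>x t. reval (poly Q (rconst t)) x = reval f (y + t *\<^sub>R (x - y))"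
  by (rule exI[of _ "\<Sum>a\<in>Poly_Mapping.keys f. smult (rconst (Poly_Mapping.lookup f a))
      (\<Prod>i\<in>UNIV. [:rconst (y $ i), rvar i - rconst (y $ i):] ^ Poly_Mapping.lookup a i)"])
    (simp add: reval_def[of f] poly_sum poly_prod reval_sum reval_mult reval_prod reval_power
      reval_add reval_diff)

lemma reval_has_directional_derivative:
  fixes f :: "'n::finite rpoly"
  shows "((\<lambda>t. reval f (y + t *\<^sub>R w)) has_real_derivative
    (\<Sum>i\<in>UNIV. w $ i * reval (rpartial i f) (y + t *\<^sub>R w))) (at t)"
proof -
  let ?z = "y + t *\<^sub>R w"
  let ?l = Poly_Mapping.lookup
  have part: "reval (rpartial i f) ?z = (\<Sum>a\<in>Poly_Mapping.keys f. ?l f a * (real (?l a i) *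
      (?z $ i) ^ (?l a i - 1) * (\<Prod>k\<in>UNIV-{i}. (?z $ k) ^ ?l a k)))" for i
  proof -
    have "(\<Prod>k\<in>UNIV. (?z $ k) ^ ?l (a - Poly_Mapping.single i 1) k)
      = (?z $ i) ^ (?l a i - 1) * (\<Prod>k\<in>UNIV-{i}. (?z $ k) ^ ?l a k)" for a
      by (subst prod.remove[of _ i]) (auto simp: lookup_minus lookup_single when_def intro!: prod.cong)
    then show ?thesis by (simp add: rpartial_def reval_sum reval_single mult.assoc)
  qed
  have mono: "((\<lambda>t. \<Prod>k\<in>UNIV. ((y + t *\<^sub>R w) $ k) ^ ?l a k) has_real_derivative
      (\<Sum>i\<in>UNIV. (real (?l a i) * (?z $ i) ^ (?l a i - 1) * w $ i) *
        (\<Prod>k\<in>UNIV-{i}. (?z $ k) ^ ?l a k))) (at t)" for a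
    by (rule has_field_derivative_prod) (auto intro!: derivative_eq_intros)
  have "((\<lambda>t. reval f (y + t *\<^sub>R w)) has_real_derivative
     (\<Sum>a\<in>Poly_Mapping.keys f. ?l f a * (\<Sum>i\<in>UNIV. (real (?l a i) * (?z $ i) ^ (?l a i - 1) * w $ i) *
        (\<Prod>k\<in>UNIV-{i}. (?z $ k) ^ ?l a k)))) (at t)"
    unfolding reval_def by (intro DERIV_sum DERIV_cmult mono)
  also have "(\<Sum>a\<in>Poly_Mapping.keys f. ?l f a * (\<Sum>i\<in>UNIV. (real (?l a i) * (?z $ i) ^ (?l a i - 1) * w $ i) *
        (\<Prod>k\<in>UNIV-{i}. (?z $ k) ^ ?l a k))) = (\<Sum>i\<in>UNIV. w $ i * reval (rpartial i f) ?z)"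
    unfolding part sum_distrib_left by (subst sum.swap) (simp only: mult_ac)
  finally show ?thesis .
qed

section \<open>First-order remainders of SOS-convex polynomials\<close>

text \<open>
  Induction via the Schur complement of the last diagonal entry. If that entry vanishes, so does its
  column, and the convention \<open>x / 0 = 0\<close> makes the same formulas work.
\<close>

lemma psd_factor:
  fixes A :: "nat \<Rightarrow> nat \<Rightarrow> real"
  assumes "\<And>a b. A a b = A b a" and "\<And>u. 0 \<le> (\<Sum>a<n. \<Sum>b<n. A a b * u a * u b)"
  shows "\<exists>V. \<forall>a<n. \<forall>b<n. A a b = (\<Sum>l<n. V l a * V l b)"
  using assms
proof (induction n arbitrary: A)
  case (Suc n)
  note sym = Suc.prems(1)
  define L where "L u = (\<Sum>a<n. A a n * u a)" for u
  have psd: "0 \<le> (\<Sum>a<n. \<Sum>b<n. A a b * u a * u b) + 2 * c * L u + A n n * c\<^sup>2" for u c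
  proof -
    \<comment> \<open>Evaluates the form of size \<open>Suc n\<close> at \<open>u\<close> extended
      by \<open>c\<close>, sorted by powers of \<open>c\<close>.\<close>
    define w where "w = u(n := c)"
    have w: "w n = c" "\<And>a. a < n \<Longrightarrow> w a = u a" by (auto simp: w_def)
    have row: "(\<Sum>b<Suc n. A a b * w a * w b) = (\<Sum>b<n. A a b * u a * u b) + c * (A a n * u a)"
      if "a < n" for a
      using that by (simp add: w)
    have last: "(\<Sum>b<n. A n b * c * u b) = c * L u"
      unfolding L_def sum_distrib_left by (intro sum.cong refl) (use sym in simp)
    have "(\<Sum>a<Suc n. \<Sum>b<Suc n. A a b * w a * w b)
      = (\<Sum>a<n. (\<Sum>b<n. A a b * u a * u b) + c * (A a n * u a)) + (c * L u + A n n * c\<^sup>2)"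
      unfolding sum.lessThan_Suc[where n = n and g = "\<lambda>a. \<Sum>b<Suc n. A a b * w a * w b"]
      by (intro arg_cong2[of _ _ _ _ "(+)"] sum.cong refl row)
        (simp_all add: last w power2_eq_square)
    also have "\<dots> = (\<Sum>a<n. \<Sum>b<n. A a b * u a * u b) + 2 * c * L u + A n n * c\<^sup>2"
      by (simp add: sum.distrib L_def sum_distrib_left mult.assoc)
    finally have "(\<Sum>a<Suc n. \<Sum>b<Suc n. A a b * w a * w b) = \<dots>" .
    then show ?thesis using Suc.prems(2)[of w] by simp
  qed
  have nn: "0 \<le> A n n"
    using psd[of "\<lambda>_. 0" 1] by (simp add: L_def)
  have L0: "L u = 0" if "A n n = 0" for u
  proof (rule ccontr)
    assume ne: "L u \<noteq> 0"
    \<comment> \<open>Without a quadratic term the form is affine in \<open>c\<close>; the value of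
      \<open>c\<close> used below makes it equal to -1.\<close>
    define F where "F = (\<Sum>a<n. \<Sum>b<n. A a b * u a * u b)"
    have "0 \<le> F + 2 * (- (F + 1) / (2 * L u)) * L u"
      using psd[of u "- (F + 1) / (2 * L u)"] that by (simp add: F_def)
    then show False using ne by (simp add: field_simps)
  qed
  define B where "B a b = A a b - A a n * A b n / A n n" for a b
  have "0 \<le> (\<Sum>a<n. \<Sum>b<n. B a b * u a * u b)" for u
  proof -
    have "(\<Sum>a<n. \<Sum>b<n. B a b * u a * u b)
      = (\<Sum>a<n. \<Sum>b<n. A a b * u a * u b) - (\<Sum>a<n. \<Sum>b<n. (A a n * u a) * (A b n * u b) / A n n)"
      by (simp add: B_def algebra_simps sum_subtractf)
    also have "(\<Sum>a<n. \<Sum>b<n. (A a n * u a) * (A b n * u b) / A n n) = (L u)\<^sup>2 / A n n"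
      by (simp add: L_def power2_eq_square sum_product sum_divide_distrib)
    \<comment> \<open>\<open>c = - L u / A n n\<close> minimizes the quadratic in \<open>c\<close>,
      and the minimum is the form of the Schur complement \<open>B\<close>. The instance
      \<open>c = 0\<close> serves the case of a vanishing pivot.\<close>
    finally show ?thesis
      using psd[of u "- L u / A n n"] psd[of u 0]
      by (cases "A n n = 0") (auto simp: power2_eq_square)
  qed
  moreover have "B a b = B b a" for a b by (simp add: B_def sym[of a b])
  ultimately obtain V where V: "\<And>a b. a < n \<Longrightarrow> b < n \<Longrightarrow> B a b = (\<Sum>l<n. V l a * V l b)"
    using Suc.IH[of B] by blast
  define W where "W l a = (if l = n then A a n / sqrt (A n n) else if a < n then V l a else 0)" for l a
  have col: "A a n = 0" if "A n n = 0" "a < n" for a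
    using L0[OF that(1), of "\<lambda>b. if b = a then 1 else 0"] that(2)
    by (simp add: L_def if_distrib cong: if_cong)
  have "A a b = (\<Sum>l<Suc n. W l a * W l b)" if "a < Suc n" "b < Suc n" for a b
  proof -
    have W_n: "W n a * W n b = A a n * A b n / A n n" using nn by (simp add: W_def)
    have "(\<Sum>l<n. W l a * W l b) = (if a < n \<and> b < n then B a b else 0)"
      by (cases "a < n"; cases "b < n") (simp_all add: W_def V)
    moreover have "A a b = (if a < n \<and> b < n then B a b else 0) + A a n * A b n / A n n"
      using that col[of a] col[of b] sym[of a b] by (cases "A n n = 0") (auto simp: B_def less_Suc_eq)
    ultimately show ?thesis using W_n by simp
  qed
  then show ?case by blast
qed simp

text \<open>
  The double antiderivative, vanishing to second order at 0, of the square of the univariate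
  polynomial with coefficients \<open>c\<close>. Being a nonnegative quadratic form in \<open>c\<close>, its value at 1
  is a sum of squares of linear forms in \<open>c\<close>; this replaces the integral remainder in Taylor's
  formula and yields polynomial squares when the coefficients are themselves polynomials.
\<close>

definition gram_form :: "nat \<Rightarrow> (nat \<Rightarrow> real) \<Rightarrow> real \<Rightarrow> real" where
  "gram_form n c t = (\<Sum>a<n. \<Sum>b<n. c a * c b * t ^ (a + b + 2) / (real (a + b + 1) * real (a + b + 2)))"

definition gram_form_deriv :: "nat \<Rightarrow> (nat \<Rightarrow> real) \<Rightarrow> real \<Rightarrow> real" where
  "gram_form_deriv n c t = (\<Sum>a<n. \<Sum>b<n. c a * c b * t ^ (a + b + 1) / real (a + b + 1))"

lemma gram_form_has_derivative:
  "(gram_form n c has_real_derivative gram_form_deriv n c t) (at t)"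
proof -
  have "((\<lambda>t. c a * c b * t ^ (a + b + 2) / (real (a + b + 1) * real (a + b + 2))) has_real_derivative
     c a * c b * t ^ (a + b + 1) / real (a + b + 1)) (at t)" for a b
  proof -
    have "((\<lambda>t. c a * c b * t ^ (a + b + 2) / (real (a + b + 1) * real (a + b + 2))) has_real_derivative
     c a * c b * (real (a + b + 2) * t ^ (a + b + 1)) / (real (a + b + 1) * real (a + b + 2))) (at t)"
      by (intro DERIV_cdivide DERIV_cmult, rule DERIV_cong[OF DERIV_pow]) simp
    moreover have "c a * c b * (r * T) / (s * r) = c a * c b * T / s" if "r \<noteq> 0" for r s T :: real
      using that by simp
    ultimately show ?thesis by (simp del: of_nat_add of_nat_Suc)
  qed
  then show ?thesis unfolding gram_form_def[abs_def] gram_form_deriv_def by (intro DERIV_sum)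
qed

lemma gram_form_deriv_has_derivative:
  "(gram_form_deriv n c has_real_derivative (\<Sum>a<n. c a * t ^ a)\<^sup>2) (at t)"
proof -
  have "((\<lambda>t. c a * c b * t ^ (a + b + 1) / real (a + b + 1)) has_real_derivative
     (c a * t ^ a) * (c b * t ^ b)) (at t)" for a b
  proof -
    have "((\<lambda>t. c a * c b * t ^ (a + b + 1) / real (a + b + 1)) has_real_derivative
     c a * c b * (real (a + b + 1) * t ^ (a + b)) / real (a + b + 1)) (at t)"
      by (intro DERIV_cdivide DERIV_cmult, rule DERIV_cong[OF DERIV_pow]) simp
    moreover have "c a * c b * (r * t ^ (a + b)) / r = (c a * t ^ a) * (c b * t ^ b)" if "r \<noteq> 0" for r :: real
      using that by (simp add: power_add)
    ultimately show ?thesis by (simp del: of_nat_add of_nat_Suc)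
  qed
  then show ?thesis
    unfolding gram_form_deriv_def[abs_def] power2_eq_square sum_product by (intro DERIV_sum)
qed

text \<open>The second derivative is a square, and the form and its first derivative vanish at 0;
  monotonicity is applied twice.\<close>

lemma gram_form_nonneg: "0 \<le> gram_form n c 1"
proof -
  have d: "0 \<le> gram_form_deriv n c t" if "0 \<le> t" for t
  proof -
    have "gram_form_deriv n c 0 \<le> gram_form_deriv n c t"
      by (rule DERIV_nonneg_imp_nondecreasing[OF that])
        (use gram_form_deriv_has_derivative in fastforce)
    then show ?thesis by (simp add: gram_form_deriv_def)
  qed
  have "gram_form n c 0 \<le> gram_form n c 1"
    by (rule DERIV_nonneg_imp_nondecreasing) (use gram_form_has_derivative d in \<open>auto intro!: exI\<close>)
  then show ?thesis by (simp add: gram_form_def)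
qed

text \<open>The matrix with entries 1/((a+b+1)(a+b+2)) is symmetric and positive semidefinite, so it
  factors. \<open>V\<close> is chosen before \<open>c\<close>; this uniformity allows polynomials to
  be substituted for the coefficients later.\<close>

lemma gram_form_eq_sum_squares:
  "\<exists>V. \<forall>c. gram_form n c 1 = (\<Sum>l<n. (\<Sum>a<n. V l a * c a)\<^sup>2)"
proof -
  define A where "A a b = 1 / (real (a + b + 1) * real (a + b + 2))" for a b
  have form: "gram_form n c 1 = (\<Sum>a<n. \<Sum>b<n. A a b * c a * c b)" for c
    unfolding gram_form_def A_def by (simp add: mult.commute)
  have "A a b = A b a" for a b by (simp add: A_def add.commute)
  then have "\<exists>V. \<forall>a<n. \<forall>b<n. A a b = (\<Sum>l<n. V l a * V l b)"
    by (rule psd_factor) (simp add: form[symmetric] gram_form_nonneg)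
  then obtain V where V: "\<And>a b. a < n \<Longrightarrow> b < n \<Longrightarrow> A a b = (\<Sum>l<n. V l a * V l b)" by blast
  have "gram_form n c 1 = (\<Sum>l<n. (\<Sum>a<n. V l a * c a)\<^sup>2)" for c
  proof -
    have "gram_form n c 1 = (\<Sum>a<n. \<Sum>b<n. \<Sum>l<n. (V l a * c a) * (V l b * c b))"
      unfolding form by (intro sum.cong refl) (simp add: V sum_distrib_left sum_distrib_right mult_ac)
    also have "\<dots> = (\<Sum>a<n. \<Sum>l<n. \<Sum>b<n. (V l a * c a) * (V l b * c b))"
      by (intro sum.cong refl sum.swap)
    also have "\<dots> = (\<Sum>l<n. \<Sum>a<n. \<Sum>b<n. (V l a * c a) * (V l b * c b))"
      by (rule sum.swap)
    finally show ?thesis by (simp add: power2_eq_square sum_product)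
  qed
  then show ?thesis by blast
qed

section \<open>Closure properties of sums of squares\<close>

lemma sum_of_squares_square: "sum_of_squares (h\<^sup>2)"
  unfolding sum_of_squares_def by (intro exI[of _ "1::nat"] exI[of _ "\<lambda>_. h"]) simp

lemma sum_of_squares_add:
  assumes "sum_of_squares f" "sum_of_squares g"
  shows "sum_of_squares (f + g)"
proof -
  obtain s :: nat and h where f: "f = (\<Sum>l<s. (h l)\<^sup>2)" using assms(1) by (auto simp: sum_of_squares_def)
  obtain s' :: nat and h' where g: "g = (\<Sum>l<s'. (h' l)\<^sup>2)" using assms(2) by (auto simp: sum_of_squares_def)
  define k where "k l = (if l < s then h l else h' (l - s))" for l
  have "(\<Sum>l<s + m. (k l)\<^sup>2) = f + (\<Sum>l<m. (h' l)\<^sup>2)" for m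
    by (induction m) (simp_all add: f k_def algebra_simps)
  then show ?thesis unfolding g sum_of_squares_def by metis
qed

lemma sum_of_squares_sum:
  assumes "\<And>k. k \<in> A \<Longrightarrow> sum_of_squares (F k)"
  shows "sum_of_squares (\<Sum>k\<in>A. F k)"
  using assms
proof (induction A rule: infinite_finite_induct)
  case (insert x A)
  then show ?case by (simp add: sum_of_squares_add)
qed (auto simp: sum_of_squares_def intro!: exI[of _ "0::nat"])

lemma sum_of_squares_square_mult:
  assumes "sum_of_squares f"
  shows "sum_of_squares (c\<^sup>2 * f)"
proof -
  obtain s :: nat and h where f: "f = (\<Sum>l<s. (h l)\<^sup>2)" using assms by (auto simp: sum_of_squares_def)
  have "c\<^sup>2 * f = (\<Sum>l<s. (c * h l)\<^sup>2)"
    by (simp add: f sum_distrib_left power_mult_distrib)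
  then show ?thesis unfolding sum_of_squares_def by (intro exI)
qed

lemma rconst_eq_square: "0 \<le> c \<Longrightarrow> rconst c = (rconst (sqrt c))\<^sup>2"
  by (simp add: rconst_def power2_eq_square mult_single)

lemma sum_of_squares_scale: "0 \<le> c \<Longrightarrow> sum_of_squares f \<Longrightarrow> sum_of_squares (rconst c * f)"
  by (subst rconst_eq_square) (simp_all add: sum_of_squares_square_mult)

lemma sum_of_squares_rconst:
  assumes "0 \<le> c"
  shows "sum_of_squares (rconst c)"
  unfolding rconst_eq_square[OF assms] by (rule sum_of_squares_square)

lemma sum_of_squares_nonneg: "sum_of_squares f \<Longrightarrow> 0 \<le> reval f x"
  by (auto simp: sum_of_squares_def reval_sum reval_power intro!: sum_nonneg)

text \<open>Along the line from \<open>y\<close> to \<open>x\<close> the second derivative of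
  \<open>f\<close> is a sum of squares of polynomials in t. Integrating twice from 0 to 1 by means
  of \<open>gram_form\<close> gives the remainder as a sum of squares of polynomials in
  \<open>x\<close>.\<close>

lemma sos_convex_tangent:
  fixes f :: "'n::finite rpoly"
  assumes "sos_convex f"
  shows "\<exists>q. sum_of_squares q \<and> (\<forall>x. reval f x = reval f y
    + (\<Sum>i\<in>UNIV. (x $ i - y $ i) * reval (rpartial i f) y) + reval q x)"
proof -
  obtain s :: nat and H where H: "\<And>i j. rhessian f i j = (\<Sum>k<s. H i k * H j k)"
    using assms by (auto simp: sos_convex_def)
  obtain Q where Q: "\<And>i k x t. reval (poly (Q i k) (rconst t)) x = reval (H i k) (y + t *\<^sub>R (x - y))"
    using reval_line_rpoly[of "H _ _" y] by metis
  \<comment> \<open>Column \<open>k\<close> of \<open>H\<close> on the line, paired with the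
    direction \<open>x - y\<close>: a polynomial in t with coefficients polynomial in
    \<open>x\<close>.\<close>
  define P where "P k = (\<Sum>i\<in>UNIV. smult (rvar i - rconst (y $ i)) (Q i k))" for k
  define N where "N k = Suc (degree (P k))" for k
  define c where "c x k a = reval (coeff (P k) a) x" for x k a
  have P: "(\<Sum>i\<in>UNIV. (x $ i - y $ i) * reval (H i k) (y + t *\<^sub>R (x - y))) = (\<Sum>a<N k. c x k a * t ^ a)"
    for x k t
  proof -
    have "(\<Sum>i\<in>UNIV. (x $ i - y $ i) * reval (H i k) (y + t *\<^sub>R (x - y))) = reval (poly (P k) (rconst t)) x"
      by (simp add: P_def poly_sum reval_sum reval_mult reval_diff Q)
    also have "\<dots> = (\<Sum>a<N k. c x k a * t ^ a)"
      by (simp add: poly_altdef reval_sum reval_mult reval_power c_def N_def lessThan_Suc_atMost)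
    finally show ?thesis .
  qed
  obtain V where V: "\<And>n c. gram_form n c 1 = (\<Sum>l<n. (\<Sum>a<n. V n l a * c a)\<^sup>2)"
    using gram_form_eq_sum_squares by metis
  \<comment> \<open>The squares that represent \<open>gram_form\<close> at 1, with the coefficients
    of \<open>P k\<close> in place of real numbers.\<close>
  define q where "q = (\<Sum>k<s. \<Sum>l<N k. (\<Sum>a<N k. rconst (V (N k) l a) * coeff (P k) a)\<^sup>2)"
  have "sum_of_squares q"
    unfolding q_def by (intro sum_of_squares_sum sum_of_squares_square)
  moreover have "reval f x = reval f y + (\<Sum>i\<in>UNIV. (x $ i - y $ i) * reval (rpartial i f) y) + reval q x" for x
  proof -
    define w where "w = x - y"
    define \<phi> where "\<phi> t = reval f (y + t *\<^sub>R w)" for t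
    define \<phi>' where "\<phi>' t = (\<Sum>i\<in>UNIV. w $ i * reval (rpartial i f) (y + t *\<^sub>R w))" for t
    \<comment> \<open>\<open>\<psi>\<close> is built to have the second derivative of
      \<open>\<phi>\<close> and to vanish at 0 together with its first derivative, so
      \<open>\<phi>\<close> and \<open>\<psi>\<close> differ by an affine function of t.\<close>
    define \<psi> where "\<psi> t = (\<Sum>k<s. gram_form (N k) (c x k) t)" for t
    define \<psi>' where "\<psi>' t = (\<Sum>k<s. gram_form_deriv (N k) (c x k) t)" for t
    have \<phi>: "(\<phi> has_real_derivative \<phi>' t) (at t)" for t
      unfolding \<phi>_def[abs_def] \<phi>'_def by (rule reval_has_directional_derivative)
    have \<psi>: "(\<psi> has_real_derivative \<psi>' t) (at t)" for t
      unfolding \<psi>_def[abs_def] \<psi>'_def by (intro DERIV_sum gram_form_has_derivative)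
    have hess: "(\<Sum>i\<in>UNIV. w $ i * (\<Sum>j\<in>UNIV. w $ j * reval (rpartial j (rpartial i f)) (y + t *\<^sub>R w)))
        = (\<Sum>k<s. (\<Sum>a<N k. c x k a * t ^ a)\<^sup>2)" for t
    proof -
      let ?h = "\<lambda>i k. w $ i * reval (H i k) (y + t *\<^sub>R w)"
      have "(\<Sum>i\<in>UNIV. w $ i * (\<Sum>j\<in>UNIV. w $ j * reval (rpartial j (rpartial i f)) (y + t *\<^sub>R w)))
        = (\<Sum>i\<in>UNIV. \<Sum>j\<in>UNIV. \<Sum>k<s. ?h i k * ?h j k)"
        using H by (simp add: rhessian_def reval_sum reval_mult sum_distrib_left mult_ac)
      also have "\<dots> = (\<Sum>i\<in>UNIV. \<Sum>k<s. \<Sum>j\<in>UNIV. ?h i k * ?h j k)"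
        by (intro sum.cong refl sum.swap)
      also have "\<dots> = (\<Sum>k<s. \<Sum>i\<in>UNIV. \<Sum>j\<in>UNIV. ?h i k * ?h j k)"
        by (rule sum.swap)
      also have "\<dots> = (\<Sum>k<s. (\<Sum>i\<in>UNIV. ?h i k)\<^sup>2)"
        by (simp add: power2_eq_square sum_product)
      finally show ?thesis using P[of x _ t] by (simp add: w_def)
    qed
    have \<phi>': "(\<phi>' has_real_derivative (\<Sum>k<s. (\<Sum>a<N k. c x k a * t ^ a)\<^sup>2)) (at t)" for t
      unfolding \<phi>'_def[abs_def] hess[symmetric]
      by (intro DERIV_sum DERIV_cmult reval_has_directional_derivative)
    have \<psi>': "(\<psi>' has_real_derivative (\<Sum>k<s. (\<Sum>a<N k. c x k a * t ^ a)\<^sup>2)) (at t)" for t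
      unfolding \<psi>'_def[abs_def] by (intro DERIV_sum gram_form_deriv_has_derivative)
    have "\<phi>' t - \<psi>' t = \<phi>' 0 - \<psi>' 0" for t
      by (rule DERIV_isconst_all[of "\<lambda>t. \<phi>' t - \<psi>' t"]) (auto intro!: derivative_eq_intros \<phi>' \<psi>')
    note const = this
    have \<psi>_0: "\<psi>' 0 = 0" "\<psi> 0 = 0"
      by (simp_all add: \<psi>_def \<psi>'_def gram_form_def gram_form_deriv_def)
    have eq: "\<phi>' t = \<psi>' t + \<phi>' 0" for t
      using const[of t] \<psi>_0 by linarith
    have "((\<lambda>t. \<phi> t - \<psi> t - t * \<phi>' 0) has_real_derivative \<phi>' t - \<psi>' t - 1 * \<phi>' 0) (at t)" for t
      by (intro DERIV_diff DERIV_cmult_right DERIV_ident \<phi> \<psi>)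
    note deriv = this
    have d0: "((\<lambda>t. \<phi> t - \<psi> t - t * \<phi>' 0) has_real_derivative 0) (at t)" for t
      using deriv[of t] by (rule DERIV_cong) (use eq[of t] in simp)
    have "\<phi> 1 - \<psi> 1 - 1 * \<phi>' 0 = \<phi> 0 - \<psi> 0 - 0 * \<phi>' 0"
      by (rule DERIV_isconst_all[of "\<lambda>t. \<phi> t - \<psi> t - t * \<phi>' 0"])
        (simp add: d0)
    then have "\<phi> 1 = \<phi> 0 + \<phi>' 0 + \<psi> 1" using \<psi>_0 by simp
    moreover have "\<psi> 1 = reval q x"
      by (simp add: \<psi>_def V q_def reval_sum reval_power reval_mult c_def)
    ultimately show ?thesis by (simp add: \<phi>_def \<phi>'_def w_def)
  qed
  ultimately show ?thesis by blast
qed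

text \<open>The remainder is nonnegative, so \<open>f\<close> lies above its tangent at the
  intermediate point \<open>z\<close>. Averaging the tangent inequalities at \<open>x\<close> and
  \<open>y\<close> cancels the linear terms.\<close>

lemma sos_convex_imp_convex_on:
  fixes f :: "'n::finite rpoly"
  assumes "sos_convex f"
  shows "convex_on UNIV (reval f)"
proof (rule convex_onI)
  fix t :: real and x y :: "real ^ 'n" assume t: "0 < t" "t < 1"
  define z where "z = (1 - t) *\<^sub>R x + t *\<^sub>R y"
  define D where "D x = (\<Sum>i\<in>UNIV. (x $ i - z $ i) * reval (rpartial i f) z)" for x
  obtain q where q: "sum_of_squares q" "\<And>u. reval f u = reval f z + D u + reval q u"
    using sos_convex_tangent[OF assms, of z] unfolding D_def by blast
  have tangent: "reval f z + D u \<le> reval f u" for u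
    using sum_of_squares_nonneg[OF q(1), of u] q(2)[of u] by linarith
  have "(1 - t) * D x + t * D y = (\<Sum>i\<in>UNIV. ((1 - t) * (x $ i - z $ i) + t * (y $ i - z $ i)) * reval (rpartial i f) z)"
    by (simp only: D_def sum_distrib_left sum.distrib[symmetric] distrib_right mult.assoc)
  also have "\<dots> = 0"
    by (intro sum.neutral) (simp add: z_def algebra_simps)
  finally have "reval f z = (1 - t) * (reval f z + D x) + t * (reval f z + D y)"
    by (simp add: algebra_simps)
  also have "\<dots> \<le> (1 - t) * reval f x + t * reval f y"
    using t by (intro add_mono mult_left_mono tangent) auto
  finally show "reval f ((1 - t) *\<^sub>R x + t *\<^sub>R y) \<le> (1 - t) * reval f x + t * reval f y"
    by (simp add: z_def)
qed simp

section \<open>Duality\<close>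

text \<open>Each \<open>F k\<close> is expanded at a common minimizer \<open>y\<close> of the
  combination \<open>L\<close>. The weighted linear terms cancel, leaving the weighted remainders
  and the nonnegative constant \<open>L y - c\<close>.\<close>

lemma sos_convex_combination_sum_of_squares:
  fixes F :: "'k \<Rightarrow> 'n::finite rpoly"
  assumes fin: "finite K" and F: "\<And>k. k \<in> K \<Longrightarrow> sos_convex (F k)"
    and w: "\<And>k. k \<in> K \<Longrightarrow> 0 \<le> w k"
    and nonneg: "\<And>x. c \<le> (\<Sum>k\<in>K. w k * reval (F k) x)"
  shows "sum_of_squares ((\<Sum>k\<in>K. rconst (w k) * F k) - rconst c)"
proof -
  define L where "L x = (\<Sum>k\<in>K. w k * reval (F k) x)" for x
  have L_reval: "L x = reval (\<Sum>k\<in>K. rconst (w k) * F k) x" for x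
    by (simp add: L_def reval_sum reval_mult)
  have "convex_on UNIV L"
    unfolding L_def[abs_def] using fin F w
    by (induction K rule: finite_induct)
      (auto simp: convex_on_const intro!: convex_on_add convex_on_cmul sos_convex_imp_convex_on)
  moreover have "\<exists>q. \<forall>t. L (x + t *\<^sub>R v) = poly q t" for x v
    unfolding L_reval by (rule reval_line_poly)
  ultimately obtain y where y: "\<And>x. L y \<le> L x"
    using convex_poly_attains_min[of L c] nonneg unfolding L_def by blast
  have "\<forall>k\<in>K. \<exists>q. sum_of_squares q \<and> (\<forall>x. reval (F k) x = reval (F k) y
    + (\<Sum>i\<in>UNIV. (x $ i - y $ i) * reval (rpartial i (F k)) y) + reval q x)"
    by (intro ballI sos_convex_tangent F)
  note bchoice[OF this]
  then obtain q where q: "\<And>k. k \<in> K \<Longrightarrow> sum_of_squares (q k)"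
    "\<And>k x. k \<in> K \<Longrightarrow> reval (F k) x = reval (F k) y
      + (\<Sum>i\<in>UNIV. (x $ i - y $ i) * reval (rpartial i (F k)) y) + reval (q k) x"
    by blast
  \<comment> \<open>Since \<open>y\<close> is a global minimizer, the radius 1 in the local minimum
    criterion is arbitrary.\<close>
  have stationary: "(\<Sum>k\<in>K. w k * reval (rpartial i (F k)) y) = 0" for i
  proof (rule DERIV_local_min)
    show "((\<lambda>t. L (y + t *\<^sub>R axis i 1)) has_real_derivative (\<Sum>k\<in>K. w k * reval (rpartial i (F k)) y)) (at 0)"
      unfolding L_def by (intro DERIV_sum DERIV_cmult reval_has_partial_derivative)
    show "(0::real) < 1" by simp
    show "\<forall>t. \<bar>0 - t\<bar> < 1 \<longrightarrow> L (y + 0 *\<^sub>R axis i 1) \<le> L (y + t *\<^sub>R axis i 1)"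
      using y by simp
  qed
  have "(\<Sum>k\<in>K. rconst (w k) * F k) - rconst c = (\<Sum>k\<in>K. rconst (w k) * q k) + rconst (L y - c)"
  proof (rule reval_inject)
    fix x
    have "L x = (\<Sum>k\<in>K. w k * reval (F k) y + w k * (\<Sum>i\<in>UNIV. (x $ i - y $ i) * reval (rpartial i (F k)) y)
        + w k * reval (q k) x)"
      unfolding L_def by (intro sum.cong refl) (simp only: q(2)[where x = x] distrib_left)
    also have "\<dots> = L y + (\<Sum>k\<in>K. w k * (\<Sum>i\<in>UNIV. (x $ i - y $ i) * reval (rpartial i (F k)) y))
        + (\<Sum>k\<in>K. w k * reval (q k) x)"
      by (simp add: sum.distrib L_def)
    also have "(\<Sum>k\<in>K. w k * (\<Sum>i\<in>UNIV. (x $ i - y $ i) * reval (rpartial i (F k)) y))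
        = (\<Sum>i\<in>UNIV. (x $ i - y $ i) * (\<Sum>k\<in>K. w k * reval (rpartial i (F k)) y))"
      unfolding sum_distrib_left by (subst sum.swap) (simp only: mult_ac)
    finally have "L x = L y + (\<Sum>k\<in>K. w k * reval (q k) x)"
      by (simp add: stationary)
    then show "reval ((\<Sum>k\<in>K. rconst (w k) * F k) - rconst c) x
        = reval ((\<Sum>k\<in>K. rconst (w k) * q k) + rconst (L y - c)) x"
      by (simp add: reval_diff reval_add L_reval[symmetric]) (simp add: reval_sum reval_mult)
  qed
  moreover have "sum_of_squares ((\<Sum>k\<in>K. rconst (w k) * q k) + rconst (L y - c))"
    using nonneg[of y]
    by (intro sum_of_squares_add sum_of_squares_sum sum_of_squares_scale sum_of_squares_rconst q w)
      (auto simp: L_def)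
  ultimately show ?thesis by simp
qed

section \<open>Degree bounds for linear combinations\<close>

lemma rdegree_le_iff:
  "rdegree f \<le> d \<longleftrightarrow> (\<forall>a\<in>Poly_Mapping.keys f. (\<Sum>i\<in>UNIV. Poly_Mapping.lookup a i) \<le> d)"
  by (simp add: rdegree_def)

lemma rdegree_rconst [simp]: "rdegree (rconst c) = 0"
proof -
  have "rdegree (rconst c :: 'a rpoly) \<le> 0"
    by (simp only: rdegree_le_iff) (auto simp: rconst_def split: if_splits)
  then show ?thesis by simp
qed

lemma rdegree_add_le: "rdegree f \<le> d \<Longrightarrow> rdegree g \<le> d \<Longrightarrow> rdegree (f + g) \<le> d"
  unfolding rdegree_le_iff using Poly_Mapping.keys_add[of f g] by blast

lemma rdegree_diff_le:
  assumes "rdegree f \<le> d" "rdegree g \<le> d"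
  shows "rdegree (f - g) \<le> d"
proof -
  have "Poly_Mapping.keys (f - g) \<subseteq> Poly_Mapping.keys f \<union> Poly_Mapping.keys g"
    by (auto simp: in_keys_iff lookup_minus)
  then show ?thesis using assms unfolding rdegree_le_iff by blast
qed

lemma rdegree_sum_le: "(\<And>k. k \<in> A \<Longrightarrow> rdegree (F k) \<le> d) \<Longrightarrow> rdegree (\<Sum>k\<in>A. F k) \<le> d"
  by (induction A rule: infinite_finite_induct) (auto simp: rdegree_def[of 0] intro: rdegree_add_le)

lemma rdegree_rconst_mult_le:
  assumes "rdegree f \<le> d"
  shows "rdegree (rconst c * f) \<le> d"
proof -
  have "Poly_Mapping.keys (rconst c * f) \<subseteq> Poly_Mapping.keys f"
    using keys_mult[of "rconst c" f] by (auto simp: rconst_def split: if_splits)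
  then show ?thesis using assms unfolding rdegree_le_iff by blast
qed

lemma sum_UNIV_sum_type:
  "(\<Sum>k\<in>UNIV. h k) = (\<Sum>j\<in>UNIV. h (Inl j)) + (\<Sum>i\<in>UNIV. h (Inr i))"
  for h :: "'r::finite + 'm::finite \<Rightarrow> 'a::comm_monoid_add"
  by (simp add: UNIV_Plus_UNIV[symmetric] sum.Plus del: UNIV_Plus_UNIV)

text \<open>Weak duality: at a feasible point the certificate is nonnegative, the constraint terms
  are at most 0, and a convex combination of the \<open>p j\<close> is at most their
  maximum.\<close>

lemma dual_value_le_primal_value: "dual_value d p g \<le> primal_value p g"
  unfolding dual_value_def primal_value_def
proof (intro Sup_least INF_greatest, clarify)
  fix x \<mu> and \<delta> :: "real ^ 'a" and lam :: "real ^ 'c"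
  assume x: "x \<in> feasible_set g" and \<delta>: "\<delta> \<in> prob_simplex" and lam: "\<forall>i. 0 \<le> lam $ i"
    and sos: "(\<Sum>j\<in>UNIV. rconst (\<delta> $ j) * p j) + (\<Sum>i\<in>UNIV. rconst (lam $ i) * g i) - rconst \<mu> \<in> sos_upto d"
  have "0 \<le> reval ((\<Sum>j\<in>UNIV. rconst (\<delta> $ j) * p j) + (\<Sum>i\<in>UNIV. rconst (lam $ i) * g i) - rconst \<mu>) x"
    using sos by (intro sum_of_squares_nonneg) (simp add: sos_upto_def)
  then have "\<mu> \<le> (\<Sum>j\<in>UNIV. \<delta> $ j * reval (p j) x) + (\<Sum>i\<in>UNIV. lam $ i * reval (g i) x)"
    by (simp add: reval_diff reval_add reval_sum reval_mult)
  also have "\<dots> \<le> (\<Sum>j\<in>UNIV. \<delta> $ j * (MAX j. reval (p j) x)) + 0"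
    using \<delta> lam x
    by (intro add_mono sum_mono mult_left_mono sum_nonpos mult_nonneg_nonpos)
      (auto simp: prob_simplex_def feasible_set_def)
  also have "\<dots> = (MAX j. reval (p j) x)"
    using \<delta> by (simp add: sum_distrib_right[symmetric] prob_simplex_def)
  finally show "ereal \<mu> \<le> ereal (MAX j. reval (p j) x)" by simp
qed

text \<open>A gap would contain a real \<open>c\<close>. The system \<open>p j \<le> c\<close>,
  \<open>g i \<le> 0\<close> then has no solution, and its normalized multipliers certify that
  \<open>c\<close> is feasible for the dual, a contradiction.\<close>

lemma primal_value_le_dual_value:
  fixes p :: "'r::finite \<Rightarrow> 'n::finite rpoly" and g :: "'m::finite \<Rightarrow> 'n rpoly"
  assumes p: "\<And>j. sos_convex (p j)" and g: "\<And>i. sos_convex (g i)"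
    and feasible: "feasible_set g \<noteq> {}"
    and deg_p: "\<And>j. rdegree (p j) \<le> d" and deg_g: "\<And>i. rdegree (g i) \<le> d"
  shows "primal_value p g \<le> dual_value d p g"
proof (rule ccontr)
  assume "\<not> ?thesis"
  then obtain c where c: "dual_value d p g < ereal c" "ereal c < primal_value p g"
    using ereal_dense2[of "dual_value d p g" "primal_value p g"] by (auto simp: not_le)
  \<comment> \<open>Objectives and constraints become one family over the sum type, so that the
    alternative yields all multipliers at once; \<open>shift\<close> subtracts \<open>c\<close> from
    the objectives only.\<close>
  define F where "F = case_sum p g"
  define shift where "shift = case_sum (\<lambda>_::'r. c) (\<lambda>_::'m. 0)"
  have F: "sos_convex (F k)" for k by (cases k) (simp_all add: F_def p g)
  have "\<exists>w b. (\<forall>k. 0 \<le> w k) \<and> 0 < b \<and> (\<forall>x. b \<le> (\<Sum>k\<in>UNIV. w k * (reval (F k) x - shift k)))"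
  proof (rule convex_poly_alternative)
    show "convex_on UNIV (\<lambda>x. reval (F k) x - shift k)" for k
      by (intro convex_on_diff_const sos_convex_imp_convex_on F)
    show "\<exists>q. \<forall>t. reval (F k) (x + t *\<^sub>R v) - shift k = poly q t" for k x v
      using reval_line_poly[of "F k - rconst (shift k)" x v] by (simp add: reval_diff)
    show "\<exists>k. 0 < reval (F k) x - shift k" for x
    proof (rule ccontr)
      assume "\<not> ?thesis"
      then have *: "\<And>k. reval (F k) x \<le> shift k" by (simp add: not_less)
      have "x \<in> feasible_set g"
        using *[of "Inr _"] by (simp add: feasible_set_def F_def shift_def)
      then have "primal_value p g \<le> ereal (MAX j. reval (p j) x)"
        unfolding primal_value_def by (rule INF_lower)
      also have "\<dots> \<le> ereal c"
        using *[of "Inl _"] by (auto simp: F_def shift_def)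
      finally show False using c(2) by simp
    qed
  qed
  then obtain w b where w: "\<And>k. 0 \<le> w k" and b: "0 < b"
    and sep: "\<And>x. b \<le> (\<Sum>k\<in>UNIV. w k * (reval (F k) x - shift k))" by blast
  define S where "S = (\<Sum>j\<in>UNIV. w (Inl j))"
  \<comment> \<open>If all objective multipliers vanished, a feasible point would make the weighted
    sum nonpositive, against \<open>b > 0\<close>. This takes the place of a constraint
    qualification.\<close>
  have "S \<noteq> 0"
  proof
    assume "S = 0"
    then have w0: "w (Inl j) = 0" for j
      using w by (simp add: S_def sum_nonneg_eq_0_iff)
    obtain x where x: "x \<in> feasible_set g" using feasible by blast
    have "(\<Sum>k\<in>UNIV. w k * (reval (F k) x - shift k)) \<le> 0"
      using x w by (auto simp: sum_UNIV_sum_type w0 F_def shift_def feasible_set_def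
        intro!: sum_nonpos mult_nonneg_nonpos)
    then show False using sep[of x] b by simp
  qed
  then have S: "0 < S" using w by (simp add: S_def sum_nonneg order_less_le)
  \<comment> \<open>Scaling puts the objective multipliers in the simplex, so the shifts add up to
    exactly \<open>c\<close>.\<close>
  define u where "u k = w k / S" for k
  have u: "0 \<le> u k" for k using w S by (simp add: u_def)
  have u1: "(\<Sum>j\<in>UNIV. u (Inl j)) = 1"
    using S by (simp add: u_def sum_divide_distrib[symmetric] S_def)
  have "c \<le> (\<Sum>k\<in>UNIV. u k * reval (F k) x)" for x
  proof -
    have "0 \<le> (\<Sum>k\<in>UNIV. w k * (reval (F k) x - shift k)) / S"
      using sep[of x] b S by simp
    also have "\<dots> = (\<Sum>k\<in>UNIV. u k * reval (F k) x) - (\<Sum>k\<in>UNIV. u k * shift k)"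
      by (simp add: sum_divide_distrib u_def sum_subtractf[symmetric] right_diff_distrib diff_divide_distrib)
    also have "(\<Sum>k\<in>UNIV. u k * shift k) = c"
      by (simp add: sum_UNIV_sum_type shift_def sum_distrib_right[symmetric] u1)
    finally show ?thesis by simp
  qed
  then have "sum_of_squares ((\<Sum>k\<in>UNIV. rconst (u k) * F k) - rconst c)"
    by (intro sos_convex_combination_sum_of_squares F u) auto
  moreover have "rdegree ((\<Sum>k\<in>UNIV. rconst (u k) * F k) - rconst c) \<le> d"
  proof (intro rdegree_diff_le rdegree_sum_le rdegree_rconst_mult_le)
    show "rdegree (F k) \<le> d" for k by (cases k) (simp_all add: F_def deg_p deg_g)
  qed simp
  ultimately have "(\<Sum>k\<in>UNIV. rconst (u k) * F k) - rconst c \<in> sos_upto d"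
    by (simp add: sos_upto_def)
  then have mem: "(\<Sum>j\<in>UNIV. rconst ((\<chi> j. u (Inl j)) $ j) * p j)
      + (\<Sum>i\<in>UNIV. rconst ((\<chi> i. u (Inr i)) $ i) * g i) - rconst c \<in> sos_upto d"
    by (simp add: sum_UNIV_sum_type F_def)
  have "(\<chi> j. u (Inl j)) \<in> prob_simplex" using u u1 by (simp add: prob_simplex_def)
  moreover have "\<forall>i. 0 \<le> (\<chi> i. u (Inr i)) $ i" using u by simp
  ultimately have "ereal c \<le> dual_value d p g"
    unfolding dual_value_def using mem by (intro Sup_upper) blast
  then show False using c(1) by simp
qed

theorem theorem3p2:
  fixes p :: "'r::finite \<Rightarrow> 'n::finite rpoly"
    and g :: "'m::finite \<Rightarrow> 'n rpoly"
    and d :: nat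
  assumes "\<And>j. sos_convex (p j)"
    and "\<And>i. sos_convex (g i)"
    and "feasible_set g \<noteq> {}"
    and "d = (LEAST e. even e \<and> e \<ge> max (MAX j. rdegree (p j)) (MAX i. rdegree (g i)))"
  shows "primal_value p g = dual_value d p g"
proof (rule antisym)
  define M where "M = max (MAX j. rdegree (p j)) (MAX i. rdegree (g i))"
  \<comment> \<open>\<open>2 * M\<close> witnesses that the least number in the definition of
    \<open>d\<close> exists.\<close>
  have "even d \<and> M \<le> d"
    unfolding assms(4) M_def[symmetric] by (rule LeastI[of _ "2 * M"]) simp
  then have "rdegree (p j) \<le> d" "rdegree (g i) \<le> d" for i j
    by (auto simp: M_def)
  then show "primal_value p g \<le> dual_value d p g"
    by (intro primal_value_le_dual_value assms(1-3))
qed (rule dual_value_le_primal_value)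

end
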